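(* Let $\mathbb{F}$ be a field, $n$ a positive integer, and let $A \in M_n(\mathbb{F})$ be a nonzero matrix. Then the following assertions are equivalent: (a) $A^r = A^{(r)}$ for every positive integer $r$; (b) $A^r = A^{(r)}$ for every integer $r \in \{2, 3, \ldots, n+1\}$; (c) There exist a positive integer $k$, distinct non-zero elements $\lambda_1, \ldots, \lambda_k \in \mathbb{F}$, and idempotent $(0,1)$-matrices $E_1, \ldots, E_k \in M_n(\mathbb{F})$ such that $$A = \sum_{i=1}^k \lambda_i E_i$$ and $$E_i \circ E_j = E_i E_j = 0 \quad \text{for all } i \neq j.$$
   Context: $M_n(\mathbb{F})$ is the algebra of all $n \times n$ matrices over the field $\mathbb{F}$. For $A = [a_{ij}]_{i,j=1}^n$ and $B = [b_{ij}]_{i,j=1}^n$ in $M_n(\mathbb{F})$, the Hadamard product is $A \circ B = [a_{ij} b_{ij}]_{i,j=1}^n$, and $AB$ denotes the usual matrix product. For a positive integer $r$, $A^{(r)} = [a_{ij}^r]_{i,j=1}^n$ is the $r$-th Hadamard power of $A$, and $A^r$ is the usual $r$-th matrix power. A $(0,1)$-matrix is a matrix each of whose entries is $0$ or $1$ (as elements of $\mathbb{F}$). A matrix $E$ is idempotent if $E^2 = E$ (usual product). *)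

theory Defs
  imports "Jordan_Normal_Form.Matrix"
begin

definition hadamard_prod :: "'a :: times mat \<Rightarrow> 'a mat \<Rightarrow> 'a mat"  (infixl "\<circ>\<^sub>m" 70) where
  "A \<circ>\<^sub>m B = mat (dim_row A) (dim_col A) (\<lambda>(i, j). A $$ (i, j) * B $$ (i, j))"

definition hadamard_pow :: "'a :: power mat \<Rightarrow> nat \<Rightarrow> 'a mat" where
  "hadamard_pow A r = mat (dim_row A) (dim_col A) (\<lambda>(i, j). (A $$ (i, j)) ^ r)"

definition zero_one_mat :: "'a :: zero_neq_one mat \<Rightarrow> bool" where
  "zero_one_mat A \<longleftrightarrow> (\<forall>i < dim_row A. \<forall>j < dim_col A. A $$ (i, j) = 0 \<or> A $$ (i, j) = 1)"

definition idempotent_mat :: "'a :: semiring_1 mat \<Rightarrow> bool" where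
  "idempotent_mat E \<longleftrightarrow> E ^\<^sub>m 2 = E"

(* Matrices have no additive type class structure (the dimensions live in the term, not in the
   type), so an indexed sum of n by n matrices is the finite sum in the module of such matrices. *)
abbreviation finsum_mat :: "nat \<Rightarrow> ('i \<Rightarrow> 'a :: semiring_1 mat) \<Rightarrow> 'i set \<Rightarrow> 'a mat" where
  "finsum_mat n \<equiv> finsum (module_mat TYPE('a) n n)"

end

(* If A^r = A^(r) for all r > 0, then evaluating a polynomial without constant term at A (in the
   matrix sense) is the same as applying it to each entry, so entrywise application of such
   polynomials is multiplicative for the matrix product; applied to Lagrange polynomials this makes
   the indicator matrices of the nonzero values of A orthogonal idempotents. To pass from (b)
   to (a), fix a row i: the polynomial q = X (X - a_i1) ... (X - a_in) is monic of degree n + 1, has no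
   constant term and kills the entries of row i, so by (b) row i of q(A) vanishes. Hence row i
   of A^r and row i of A^(r) satisfy the same linear recurrence of order n + 1. *)

theory Submission
  imports Defs "HOL-Computational_Algebra.Polynomial"
begin

section \<open>Entrywise formulas for sums, products and powers of matrices\<close>

lemma index_finsum_mat:
  fixes f :: "'i \<Rightarrow> 'a :: comm_ring_1 mat"
  assumes "finite S" "\<And>t. t \<in> S \<Longrightarrow> f t \<in> carrier_mat n n" "i < n" "j < n"
  shows "finsum_mat n f S $$ (i, j) = (\<Sum>t\<in>S. f t $$ (i, j))"
proof -
  interpret abelian_group "module_mat TYPE('a) n n"
    by (rule abelian_group_mat)
  \<comment> \<open>Carrier membership travels through the induction because reading an entry of a
    matrix sum requires the dimensions of its second summand.\<close>
  have "finsum_mat n f S \<in> carrier_mat n n \<and>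
      finsum_mat n f S $$ (i, j) = (\<Sum>t\<in>S. f t $$ (i, j))"
    using assms(1,2)
  proof (induction S rule: finite_induct)
    case empty
    then show ?case using assms(3,4) by (simp add: module_mat_simps)
  next
    case (insert t S)
    have "finsum_mat n f (insert t S) = f t + finsum_mat n f S"
      using finsum_insert[OF insert(1,2), of f] insert.prems
      by (simp add: module_mat_simps Pi_def)
    moreover have "f t \<in> carrier_mat n n" and IH: "finsum_mat n f S \<in> carrier_mat n n"
      "finsum_mat n f S $$ (i, j) = (\<Sum>t\<in>S. f t $$ (i, j))"
      using insert by auto
    moreover have "(f t + finsum_mat n f S) $$ (i, j) = f t $$ (i, j) + finsum_mat n f S $$ (i, j)"
      by (rule index_add_mat(1)) (use carrier_matD[OF IH(1)] assms(3,4) in auto)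
    ultimately show ?case using insert.hyps by simp
  qed
  then show ?thesis ..
qed

lemma finsum_mat_carrier:
  fixes f :: "'i \<Rightarrow> 'a :: comm_ring_1 mat"
  assumes "\<And>t. t \<in> S \<Longrightarrow> f t \<in> carrier_mat n n"
  shows "finsum_mat n f S \<in> carrier_mat n n"
proof -
  interpret abelian_group "module_mat TYPE('a) n n"
    by (rule abelian_group_mat)
  show ?thesis
    using finsum_closed[of f S] assms by (simp add: module_mat_simps Pi_def)
qed

lemma index_mult_mat_sum:
  assumes "A \<in> carrier_mat n m" "B \<in> carrier_mat m p" "i < n" "j < p"
  shows "(A * B) $$ (i, j) = (\<Sum>k<m. A $$ (i, k) * B $$ (k, j))"
  using assms by (simp add: scalar_prod_def atLeast0LessThan)

lemma pow_mat_add: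
  fixes A :: "'a :: semiring_1 mat"
  assumes "A \<in> carrier_mat n n"
  shows "A ^\<^sub>m (r + s) = A ^\<^sub>m r * A ^\<^sub>m s"
proof (induction s)
  case 0
  show ?case using assms by (simp add: right_mult_one_mat[OF pow_carrier_mat[OF assms]])
next
  case (Suc s)
  then show ?case
    using assoc_mult_mat[OF pow_carrier_mat[OF assms] pow_carrier_mat[OF assms] assms] by simp
qed

lemma hadamard_pow_index:
  assumes "A \<in> carrier_mat n n" "i < n" "j < n"
  shows "hadamard_pow A r $$ (i, j) = A $$ (i, j) ^ r"
  using assms by (simp add: hadamard_pow_def)

lemma pow_mat_eq_hadamard_pow_iff:
  assumes "A \<in> carrier_mat n n"
  shows "A ^\<^sub>m r = hadamard_pow A r \<longleftrightarrow>
    (\<forall>i<n. \<forall>j<n. (A ^\<^sub>m r) $$ (i, j) = A $$ (i, j) ^ r)"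
proof
  assume "A ^\<^sub>m r = hadamard_pow A r"
  then show "\<forall>i<n. \<forall>j<n. (A ^\<^sub>m r) $$ (i, j) = A $$ (i, j) ^ r"
    using hadamard_pow_index[OF assms] by simp
next
  assume *: "\<forall>i<n. \<forall>j<n. (A ^\<^sub>m r) $$ (i, j) = A $$ (i, j) ^ r"
  show "A ^\<^sub>m r = hadamard_pow A r"
    by (rule eq_matI) (use assms * in \<open>auto simp: hadamard_pow_def\<close>)
qed

section \<open>From finitely many exponents to all exponents\<close>

text \<open>Strong induction on the exponent within a fixed row. The recurrence has leading
  coefficient 1, so its top term is determined by the lower ones without division, and a commutative
  ring suffices.\<close>

lemma hadamard_pow_extend:
  fixes A :: "'a :: comm_ring_1 mat"
  assumes A: "A \<in> carrier_mat n n"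
    and low: "\<And>r. 2 \<le> r \<Longrightarrow> r \<le> n + 1 \<Longrightarrow> A ^\<^sub>m r = hadamard_pow A r"
    and "r > 0"
  shows "A ^\<^sub>m r = hadamard_pow A r"
proof -
  \<comment> \<open>Exponent 1 is trivial, so the range starting at 2 in the hypothesis already
    gives all of 1 to n + 1.\<close>
  have low': "(A ^\<^sub>m r) $$ (i, j) = A $$ (i, j) ^ r" if "0 < r" "r \<le> n + 1" "i < n" "j < n" for r i j
  proof (cases "r = 1")
    case True
    then show ?thesis using A by simp
  next
    case False
    then show ?thesis
      using low[of r] pow_mat_eq_hadamard_pow_iff[OF A, of r] that by simp
  qed
  have "(A ^\<^sub>m r) $$ (i, j) = A $$ (i, j) ^ r" if i: "i < n" and "j < n" for i j
    using \<open>r > 0\<close> \<open>j < n\<close>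
  proof (induction r arbitrary: j rule: less_induct)
    case (less r)
    \<comment> \<open>\<open>pCons 0\<close> multiplies by X. The resulting zero constant term hides
      exponent 0, where the matrix power is the identity but every entrywise power is 1.\<close>
    define q where "q = pCons 0 (\<Prod>l<n. [:- A $$ (i, l), 1:])"
    \<comment> \<open>In the presence of zero divisors the degree of a product can drop, so degree
      and leading coefficient are established together.\<close>
    have mon: "degree (\<Prod>l<m. [:- A $$ (i, l), 1:]) = m \<and> coeff (\<Prod>l<m. [:- A $$ (i, l), 1:]) m = 1" for m
    proof (induction m)
      case (Suc m)
      let ?p = "\<Prod>l<m. [:- A $$ (i, l), 1:]"
      have "degree (?p * [:- A $$ (i, m), 1:]) \<le> Suc m"
        using degree_mult_le[of ?p "[:- A $$ (i, m), 1:]"] Suc by simp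
      moreover have "coeff (?p * [:- A $$ (i, m), 1:]) (Suc m) = 1"
        using coeff_mult_degree_sum[of ?p "[:- A $$ (i, m), 1:]"] Suc by simp
      ultimately show ?case
        by (simp add: le_antisym le_degree)
    qed simp
    have deg: "degree q = n + 1" and top: "coeff q (n + 1) = 1" and q0: "coeff q 0 = 0"
      using mon[of n] by (auto simp: q_def degree_pCons_eq_if)
    have root: "poly q (A $$ (i, k)) = 0" if "k < n" for k
    proof -
      have "(\<Prod>l<n. A $$ (i, k) - A $$ (i, l)) = 0"
        using that by (intro prod_zero) auto
      then show ?thesis by (simp add: q_def poly_prod)
    qed
    have ev: "(\<Sum>s\<le>n + 1. coeff q s * A $$ (i, k) ^ s) = 0" if "k < n" for k
      using root[OF that] deg by (simp add: poly_altdef)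
    \<comment> \<open>Row i of q(A) is zero: all exponents that occur with a nonzero coefficient lie
      between 1 and n + 1.\<close>
    have rowq: "(\<Sum>s\<le>n + 1. coeff q s * (A ^\<^sub>m s) $$ (i, k)) = 0" if "k < n" for k
    proof -
      have "coeff q s * (A ^\<^sub>m s) $$ (i, k) = coeff q s * A $$ (i, k) ^ s" if "s \<le> n + 1" for s
        using low'[OF _ that i \<open>k < n\<close>] q0 by (cases "s = 0") auto
      then show ?thesis
        using ev[OF that] by simp
    qed
    show ?case
    proof (cases "r \<le> n + 1")
      case True
      then show ?thesis using low' i less.prems by simp
    next
      case False
      define m where "m = r - (n + 1)"
      have r: "r = n + 1 + m" using False by (simp add: m_def)
      \<comment> \<open>This is entry (i, j) of q(A) times the m-th power of A. Row i of a product
        depends only on row i of its left factor, which is why a polynomial chosen for this single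
        row is enough.\<close>
      have "(\<Sum>s\<le>n + 1. coeff q s * (A ^\<^sub>m (s + m)) $$ (i, j))
          = (\<Sum>s\<le>n + 1. \<Sum>k<n. coeff q s * (A ^\<^sub>m s) $$ (i, k) * (A ^\<^sub>m m) $$ (k, j))"
        using index_mult_mat_sum[OF pow_carrier_mat[OF A] pow_carrier_mat[OF A] i \<open>j < n\<close>]
        by (simp only: pow_mat_add[OF A] sum_distrib_left mult.assoc)
      also have "\<dots> = (\<Sum>k<n. (\<Sum>s\<le>n + 1. coeff q s * (A ^\<^sub>m s) $$ (i, k)) * (A ^\<^sub>m m) $$ (k, j))"
        unfolding sum_distrib_right by (rule sum.swap)
      also have "\<dots> = 0"
        by (rule sum.neutral) (use rowq in simp)
      finally have mat_rec: "(\<Sum>s\<le>n. coeff q s * (A ^\<^sub>m (s + m)) $$ (i, j)) + (A ^\<^sub>m r) $$ (i, j) = 0"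
        using top by (simp add: r)
      have "(\<Sum>s\<le>n + 1. coeff q s * A $$ (i, j) ^ (s + m)) =
          (\<Sum>s\<le>n + 1. coeff q s * A $$ (i, j) ^ s) * A $$ (i, j) ^ m"
        by (simp only: power_add sum_distrib_right mult.assoc)
      then have pow_rec: "(\<Sum>s\<le>n. coeff q s * A $$ (i, j) ^ (s + m)) + A $$ (i, j) ^ r = 0"
        using ev[OF \<open>j < n\<close>] top by (simp add: r)
      \<comment> \<open>For s at most n the exponent s + m is below r, so the induction hypothesis
        applies; it needs a positive exponent, and s = 0 is covered by the zero coefficient.\<close>
      have "coeff q s * (A ^\<^sub>m (s + m)) $$ (i, j) = coeff q s * A $$ (i, j) ^ (s + m)" if "s \<le> n" for s
        using less.IH[of "s + m" j] \<open>j < n\<close> that q0 by (cases "s = 0") (auto simp: r)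
      then have "(\<Sum>s\<le>n. coeff q s * (A ^\<^sub>m (s + m)) $$ (i, j)) = (\<Sum>s\<le>n. coeff q s * A $$ (i, j) ^ (s + m))"
        by (intro sum.cong) auto
      with mat_rec pow_rec show ?thesis
        by (simp only: add_eq_0_iff)
    qed
  qed
  then show ?thesis
    using pow_mat_eq_hadamard_pow_iff[OF A] by blast
qed

section \<open>Polynomials applied entrywise and indicator matrices\<close>

text \<open>For p without constant term the entrywise image is the matrix polynomial p(A), and p(A)
  q(A) = (pq)(A).\<close>

lemma map_mat_poly_mult:
  fixes A :: "'a :: comm_ring_1 mat"
  assumes A: "A \<in> carrier_mat n n"
    and pow: "\<And>r. r > 0 \<Longrightarrow> A ^\<^sub>m r = hadamard_pow A r"
    and p0: "coeff p 0 = 0" and q0: "coeff q 0 = 0"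
  shows "map_mat (poly p) A * map_mat (poly q) A = map_mat (poly (p * q)) A"
proof (rule eq_matI)
  fix i j
  assume "i < dim_row (map_mat (poly (p * q)) A)" "j < dim_col (map_mat (poly (p * q)) A)"
  then have ij: "i < n" "j < n" using A by auto
  have pow': "(A ^\<^sub>m r) $$ (i, j) = A $$ (i, j) ^ r" if "r > 0" "i < n" "j < n" for r i j
    using pow[OF that(1)] pow_mat_eq_hadamard_pow_iff[OF A] that by blast
  have ev: "poly f (A $$ (i, j)) = (\<Sum>r\<le>degree f. coeff f r * (A ^\<^sub>m r) $$ (i, j))"
    if "coeff f 0 = 0" "i < n" "j < n" for f i j
    unfolding poly_altdef
  proof (rule sum.cong[OF refl])
    fix r
    show "coeff f r * A $$ (i, j) ^ r = coeff f r * (A ^\<^sub>m r) $$ (i, j)"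
      using pow'[of r i j] that by (cases "r = 0") auto
  qed
  have "(map_mat (poly p) A * map_mat (poly q) A) $$ (i, j) =
      (\<Sum>k<n. poly p (A $$ (i, k)) * poly q (A $$ (k, j)))"
    using index_mult_mat_sum[of "map_mat (poly p) A" n n "map_mat (poly q) A" n] A ij by simp
  also have "\<dots> = (\<Sum>k<n. \<Sum>r\<le>degree p. \<Sum>s\<le>degree q.
      coeff p r * coeff q s * ((A ^\<^sub>m r) $$ (i, k) * (A ^\<^sub>m s) $$ (k, j)))"
    using ij by (intro sum.cong refl) (simp add: ev p0 q0 sum_product mult_ac)
  \<comment> \<open>With the sum over k innermost, the products of entries combine into an entry of
    the power r + s.\<close>
  also have "\<dots> = (\<Sum>r\<le>degree p. \<Sum>s\<le>degree q. \<Sum>k<n.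
      coeff p r * coeff q s * ((A ^\<^sub>m r) $$ (i, k) * (A ^\<^sub>m s) $$ (k, j)))"
    by (subst sum.swap) (rule sum.cong[OF refl], rule sum.swap)
  also have "\<dots> = (\<Sum>r\<le>degree p. \<Sum>s\<le>degree q. coeff p r * coeff q s * (A ^\<^sub>m (r + s)) $$ (i, j))"
    using index_mult_mat_sum[OF pow_carrier_mat[OF A] pow_carrier_mat[OF A] ij]
    by (simp only: pow_mat_add[OF A] sum_distrib_left)
  also have "\<dots> = (\<Sum>r\<le>degree p. \<Sum>s\<le>degree q.
      (coeff p r * A $$ (i, j) ^ r) * (coeff q s * A $$ (i, j) ^ s))"
  proof (intro sum.cong[OF refl])
    fix r s
    show "coeff p r * coeff q s * (A ^\<^sub>m (r + s)) $$ (i, j) =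
        (coeff p r * A $$ (i, j) ^ r) * (coeff q s * A $$ (i, j) ^ s)"
      \<comment> \<open>Once r is positive so is r + s, whatever s is; the case r = 0 vanishes
        through \<open>p0\<close>.\<close>
      using pow'[of "r + s" i j] ij p0 by (cases "r = 0") (auto simp: power_add)
  qed
  also have "\<dots> = poly (p * q) (A $$ (i, j))"
    by (simp only: poly_mult poly_altdef[of p] poly_altdef[of q] sum_product)
  finally show "(map_mat (poly p) A * map_mat (poly q) A) $$ (i, j) = map_mat (poly (p * q)) A $$ (i, j)"
    using A ij by simp
qed (use A in auto)

text \<open>Lagrange interpolation at the points of S together with 0 and v. The extra node 0 forces
  the constant term to vanish, since v is nonzero.\<close>

lemma lagrange_indicator:
  fixes v :: "'a :: field"
  assumes "finite S" "v \<noteq> 0"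
  obtains p where "coeff p 0 = 0" "\<And>x. x \<in> insert 0 S \<Longrightarrow> poly p x = (if x = v then 1 else 0)"
proof
  let ?q = "\<Prod>w\<in>insert 0 S - {v}. [:- w, 1:]"
  let ?p = "smult (inverse (poly ?q v)) ?q"
  have "poly ?q v \<noteq> 0"
    using assms(1) by (simp add: poly_prod)
  moreover have "poly ?q x = 0" if "x \<in> insert 0 S" "x \<noteq> v" for x
    unfolding poly_prod using assms(1) that by (intro prod_zero) auto
  ultimately show *: "poly ?p x = (if x = v then 1 else 0)" if "x \<in> insert 0 S" for x
    using that by simp
  show "coeff ?p 0 = 0"
    using *[of 0] assms(2) by (simp add: poly_0_coeff_0)
qed

text \<open>Lagrange polynomials for v and w agree with the indicators on all entries of A, so
  multiplicativity carries over. The case v = w gives idempotence, the case of distinct values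
  orthogonality.\<close>

lemma indicator_mat_mult:
  fixes A :: "'a :: field mat"
  assumes A: "A \<in> carrier_mat n n"
    and pow: "\<And>r. r > 0 \<Longrightarrow> A ^\<^sub>m r = hadamard_pow A r"
    and "v \<noteq> 0" "w \<noteq> 0"
  shows "map_mat (\<lambda>x. of_bool (x = v) :: 'a) A * map_mat (\<lambda>x. of_bool (x = w) :: 'a) A =
    map_mat (\<lambda>x. of_bool (x = v \<and> x = w) :: 'a) A"
proof -
  have fin: "finite (elements_mat A)"
    by (simp add: elements_mat_def)
  have mem: "A $$ (i, j) \<in> elements_mat A" if "i < dim_row A" "j < dim_col A" for i j
    using that by blast
  obtain p where p: "coeff p 0 = 0" "\<And>x. x \<in> insert 0 (elements_mat A) \<Longrightarrow> poly p x = (if x = v then 1 else 0)"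
    using lagrange_indicator[OF fin \<open>v \<noteq> 0\<close>] by blast
  obtain q where q: "coeff q 0 = 0" "\<And>x. x \<in> insert 0 (elements_mat A) \<Longrightarrow> poly q x = (if x = w then 1 else 0)"
    using lagrange_indicator[OF fin \<open>w \<noteq> 0\<close>] by blast
  have "map_mat (\<lambda>x. of_bool (x = v) :: 'a) A = map_mat (poly p) A"
    "map_mat (\<lambda>x. of_bool (x = w) :: 'a) A = map_mat (poly q) A"
    "map_mat (\<lambda>x. of_bool (x = v \<and> x = w) :: 'a) A = map_mat (poly (p * q)) A"
    by (rule eq_matI; use mem p(2) q(2) in auto)+
  then show ?thesis
    using map_mat_poly_mult[OF A pow p(1) q(1)] by (simp only:)
qed

section \<open>Decomposition into orthogonal idempotents\<close>

text \<open>The witnesses: \<open>k\<close> counts the distinct nonzero entries of A,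
  \<open>l\<close> enumerates them, and \<open>E t\<close> marks the positions where the entry is
  \<open>l t\<close>.\<close>

lemma idempotent_decomposition_exists:
  fixes A :: "'a :: field mat"
  assumes A: "A \<in> carrier_mat n n" and "A \<noteq> 0\<^sub>m n n"
    and pow: "\<And>r. r > 0 \<Longrightarrow> A ^\<^sub>m r = hadamard_pow A r"
  shows "\<exists>(k :: nat) (l :: nat \<Rightarrow> 'a) (E :: nat \<Rightarrow> 'a mat).
            k > 0 \<and>
            inj_on l {1 .. k} \<and>
            (\<forall>i \<in> {1 .. k}. l i \<noteq> 0) \<and>
            (\<forall>i \<in> {1 .. k}. E i \<in> carrier_mat n n \<and> idempotent_mat (E i) \<and> zero_one_mat (E i)) \<and>
            A = finsum_mat n (\<lambda>i. l i \<cdot>\<^sub>m E i) {1 .. k} \<and>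
            (\<forall>i \<in> {1 .. k}. \<forall>j \<in> {1 .. k}. i \<noteq> j \<longrightarrow>
               E i \<circ>\<^sub>m E j = 0\<^sub>m n n \<and> E i * E j = 0\<^sub>m n n)"
proof -
  define S where "S = elements_mat A - {0}"
  have fin: "finite S"
    by (simp add: S_def elements_mat_def)
  have mem: "A $$ (i, j) \<in> S" if "i < n" "j < n" "A $$ (i, j) \<noteq> 0" for i j
    using that A by (auto simp: S_def)
  have "S \<noteq> {}"
  proof
    assume "S = {}"
    then have "A = 0\<^sub>m n n"
      using A mem by (intro eq_matI) auto
    with assms(2) show False ..
  qed
  obtain l where l: "bij_betw l {1..card S} S"
    using ex_bij_betw_nat_finite_1[OF fin] by blast
  have inj: "inj_on l {1..card S}" and img: "l ` {1..card S} = S"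
    using l by (auto simp: bij_betw_def)
  have nz: "l t \<noteq> 0" if "t \<in> {1..card S}" for t
    using img that by (auto simp: S_def)
  define E where "E t = map_mat (\<lambda>x. of_bool (x = l t) :: 'a) A" for t
  have E: "E t \<in> carrier_mat n n" for t
    using A by (simp add: E_def)
  have EE: "E s * E t = map_mat (\<lambda>x. of_bool (x = l s \<and> x = l t)) A"
    if "s \<in> {1..card S}" "t \<in> {1..card S}" for s t
    unfolding E_def using indicator_mat_mult[OF A pow nz[OF that(1)] nz[OF that(2)]] .
  have disj: "l s \<noteq> l t" if "s \<in> {1..card S}" "t \<in> {1..card S}" "s \<noteq> t" for s t
    using inj that by (auto dest: inj_onD)
  have "idempotent_mat (E t)" if "t \<in> {1..card S}" for t
    using EE[OF that that] A by (simp add: idempotent_mat_def numeral_2_eq_2 E_def)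
  moreover have "zero_one_mat (E t)" for t
    by (simp add: zero_one_mat_def E_def)
  moreover have "A = finsum_mat n (\<lambda>t. l t \<cdot>\<^sub>m E t) {1..card S}" (is "A = ?B")
  proof -
    have B: "?B \<in> carrier_mat n n"
      by (rule finsum_mat_carrier) (use E in auto)
    have "A $$ (i, j) = ?B $$ (i, j)" if ij: "i < n" "j < n" for i j
    proof -
      have "?B $$ (i, j) = (\<Sum>t\<in>{1..card S}. l t * of_bool (A $$ (i, j) = l t))"
        using A E ij by (subst index_finsum_mat) (auto simp: E_def)
      also have "\<dots> = (\<Sum>v\<in>S. v * of_bool (A $$ (i, j) = v))"
        by (rule sum.reindex_bij_betw[OF l])
      also have "\<dots> = (\<Sum>v\<in>S. if A $$ (i, j) = v then A $$ (i, j) else 0)"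
        by (rule sum.cong) auto
      \<comment> \<open>A nonzero entry matches exactly one v in S; for a zero entry every summand
        is 0.\<close>
      also have "\<dots> = A $$ (i, j)"
        using fin mem[OF ij] by auto
      finally show ?thesis ..
    qed
    then show ?thesis
      using A B by (intro eq_matI) auto
  qed
  moreover have "E s \<circ>\<^sub>m E t = 0\<^sub>m n n \<and> E s * E t = 0\<^sub>m n n"
    if "s \<in> {1..card S}" "t \<in> {1..card S}" "s \<noteq> t" for s t
    using A disj[OF that] EE[OF that(1,2)]
    by (auto simp: E_def hadamard_prod_def intro!: eq_matI)
  moreover have "card S > 0"
    using fin \<open>S \<noteq> {}\<close> by (simp add: card_gt_0_iff)
  ultimately show ?thesis
    using inj nz E
    by (intro exI[of _ "card S"] exI[of _ l] exI[of _ E] conjI ballI impI) metis+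
qed

section \<open>Powers of an orthogonal decomposition\<close>

text \<open>Serves both products: \<open>e s t\<close> will be an entry of the matrix product of two
  idempotents, and then of their Hadamard product.\<close>

lemma sum_orthogonal_mult:
  fixes f g :: "'i \<Rightarrow> 'a :: comm_semiring_1"
  assumes "finite T" "\<And>s t. s \<in> T \<Longrightarrow> t \<in> T \<Longrightarrow> e s t = (if s = t then d s else 0)"
  shows "(\<Sum>s\<in>T. \<Sum>t\<in>T. f s * g t * e s t) = (\<Sum>t\<in>T. f t * g t * d t)"
proof (rule sum.cong[OF refl])
  fix s assume "s \<in> T"
  then have "(\<Sum>t\<in>T. f s * g t * e s t) = (\<Sum>t\<in>T. if s = t then f s * g s * d s else 0)"
    using assms(2) by (intro sum.cong) auto
  then show "(\<Sum>t\<in>T. f s * g t * e s t) = f s * g s * d s"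
    using assms(1) \<open>s \<in> T\<close> by simp
qed

text \<open>The \<open>E t\<close> are orthogonal idempotents for both products, so either r-th
  power of A equals the sum of the \<open>l t ^ r\<close> multiples of the
  \<open>E t\<close>.\<close>

lemma idempotent_decomposition_hadamard_pow:
  fixes A :: "'a :: comm_ring_1 mat" and l :: "'i \<Rightarrow> 'a"
  assumes T: "finite T"
    and E: "\<And>t. t \<in> T \<Longrightarrow> E t \<in> carrier_mat n n"
    and idem: "\<And>t. t \<in> T \<Longrightarrow> idempotent_mat (E t)"
    and zo: "\<And>t. t \<in> T \<Longrightarrow> zero_one_mat (E t)"
    and A: "A = finsum_mat n (\<lambda>t. l t \<cdot>\<^sub>m E t) T"
    and had: "\<And>s t. s \<in> T \<Longrightarrow> t \<in> T \<Longrightarrow> s \<noteq> t \<Longrightarrow> E s \<circ>\<^sub>m E t = 0\<^sub>m n n"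
    and orth: "\<And>s t. s \<in> T \<Longrightarrow> t \<in> T \<Longrightarrow> s \<noteq> t \<Longrightarrow> E s * E t = 0\<^sub>m n n"
    and "r > 0"
  shows "A ^\<^sub>m r = hadamard_pow A r"
proof -
  have carA: "A \<in> carrier_mat n n"
    unfolding A by (rule finsum_mat_carrier) (use E in auto)
  have idxA: "A $$ (i, j) = (\<Sum>t\<in>T. l t * E t $$ (i, j))" if "i < n" "j < n" for i j
    unfolding A using that T E index_finsum_mat[of T "\<lambda>t. l t \<cdot>\<^sub>m E t" n i j]
    by (fastforce dest: carrier_matD intro: sum.cong)
  have EE: "(\<Sum>k<n. E s $$ (i, k) * E t $$ (k, j)) = (if s = t then E s $$ (i, j) else 0)"
    if "s \<in> T" "t \<in> T" "i < n" "j < n" for s t i j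
  proof (cases "s = t")
    case True
    have "E s * E s = E s"
      using idem[OF that(1)] E[OF that(1)] by (simp add: idempotent_mat_def numeral_2_eq_2)
    then show ?thesis
      using index_mult_mat_sum[OF E[OF that(1)] E[OF that(2)] that(3,4)] True by simp
  next
    case False
    then show ?thesis
      using index_mult_mat_sum[OF E[OF that(1)] E[OF that(2)] that(3,4)] orth[OF that(1,2)] that by simp
  qed
  \<comment> \<open>Entries 0 and 1 satisfy x * x = x, so a (0,1)-matrix is idempotent for the
    Hadamard product.\<close>
  have HH: "E s $$ (i, j) * E t $$ (i, j) = (if s = t then E s $$ (i, j) else 0)"
    if "s \<in> T" "t \<in> T" "i < n" "j < n" for s t i j
  proof (cases "s = t")
    case True
    then show ?thesis
      using zo[OF that(1)] carrier_matD[OF E[OF that(1)]] that(3,4)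
      by (metis mult_zero_left mult_1 zero_one_mat_def)
  next
    case False
    have "(E s \<circ>\<^sub>m E t) $$ (i, j) = E s $$ (i, j) * E t $$ (i, j)"
      using E[OF that(1)] that by (simp add: hadamard_prod_def)
    then show ?thesis
      using had[OF that(1,2) False] False that by simp
  qed
  \<comment> \<open>Counting from \<open>Suc m\<close> makes A itself the base case; the formula may
    fail at exponent 0, as the \<open>E t\<close> need not sum to the identity.\<close>
  have mat_pow: "(A ^\<^sub>m Suc m) $$ (i, j) = (\<Sum>t\<in>T. l t ^ Suc m * E t $$ (i, j))" if "i < n" "j < n" for m i j
    using that
  proof (induction m arbitrary: i j)
    case 0
    then show ?case using idxA carA by simp
  next
    case (Suc m)
    have "(A ^\<^sub>m Suc (Suc m)) $$ (i, j) =
        (\<Sum>k<n. (\<Sum>s\<in>T. l s ^ Suc m * E s $$ (i, k)) * (\<Sum>t\<in>T. l t * E t $$ (k, j)))"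
      using index_mult_mat_sum[OF pow_carrier_mat[OF carA, of "Suc m"] carA Suc.prems] Suc.IH Suc.prems idxA
      by (simp del: power_Suc)
    also have "\<dots> = (\<Sum>k<n. \<Sum>s\<in>T. \<Sum>t\<in>T. l s ^ Suc m * l t * (E s $$ (i, k) * E t $$ (k, j)))"
      unfolding sum_product by (intro sum.cong refl) (simp only: mult_ac)
    \<comment> \<open>Moving the sum over k inside exposes the entry (i, j) of
      \<open>E s * E t\<close>, to which \<open>EE\<close> applies.\<close>
    also have "\<dots> = (\<Sum>s\<in>T. \<Sum>t\<in>T. l s ^ Suc m * l t * (\<Sum>k<n. E s $$ (i, k) * E t $$ (k, j)))"
      unfolding sum_distrib_left by (subst sum.swap) (rule sum.cong[OF refl], rule sum.swap)
    also have "\<dots> = (\<Sum>t\<in>T. l t ^ Suc m * l t * E t $$ (i, j))"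
      using EE Suc.prems by (intro sum_orthogonal_mult[OF T]) auto
    finally show ?case by (simp add: mult_ac)
  qed
  have had_pow: "A $$ (i, j) ^ Suc m = (\<Sum>t\<in>T. l t ^ Suc m * E t $$ (i, j))" if "i < n" "j < n" for m i j
  proof (induction m)
    case 0
    then show ?case using idxA that by simp
  next
    case (Suc m)
    have "A $$ (i, j) ^ Suc (Suc m) =
        (\<Sum>s\<in>T. l s ^ Suc m * E s $$ (i, j)) * (\<Sum>t\<in>T. l t * E t $$ (i, j))"
      using Suc idxA[OF that] by (simp add: mult_ac)
    also have "\<dots> = (\<Sum>s\<in>T. \<Sum>t\<in>T. l s ^ Suc m * l t * (E s $$ (i, j) * E t $$ (i, j)))"
      unfolding sum_product by (intro sum.cong refl) (simp only: mult_ac)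
    also have "\<dots> = (\<Sum>t\<in>T. l t ^ Suc m * l t * E t $$ (i, j))"
      using HH that by (intro sum_orthogonal_mult[OF T]) auto
    finally show ?case by (simp add: mult_ac)
  qed
  obtain m where "r = Suc m"
    using \<open>r > 0\<close> gr0_implies_Suc by blast
  then show ?thesis
    unfolding pow_mat_eq_hadamard_pow_iff[OF carA] using mat_pow had_pow by simp
qed

theorem theorem1:
  fixes A :: "'a :: field mat" and n :: nat
  assumes "n > 0"
    and "A \<in> carrier_mat n n"
    and "A \<noteq> 0\<^sub>m n n"
  defines "a \<equiv> (\<forall>r :: nat. r > 0 \<longrightarrow> A ^\<^sub>m r = hadamard_pow A r)"
    and "b \<equiv> (\<forall>r \<in> {2 .. n + 1}. A ^\<^sub>m r = hadamard_pow A r)"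
    and "c \<equiv> (\<exists>(k :: nat) (l :: nat \<Rightarrow> 'a) (E :: nat \<Rightarrow> 'a mat).
            k > 0 \<and>
            inj_on l {1 .. k} \<and>
            (\<forall>i \<in> {1 .. k}. l i \<noteq> 0) \<and>
            (\<forall>i \<in> {1 .. k}. E i \<in> carrier_mat n n \<and> idempotent_mat (E i) \<and> zero_one_mat (E i)) \<and>
            A = finsum_mat n (\<lambda>i. l i \<cdot>\<^sub>m E i) {1 .. k} \<and>
            (\<forall>i \<in> {1 .. k}. \<forall>j \<in> {1 .. k}. i \<noteq> j \<longrightarrow>
               E i \<circ>\<^sub>m E j = 0\<^sub>m n n \<and> E i * E j = 0\<^sub>m n n))"
  shows "(a \<longleftrightarrow> b) \<and> (b \<longleftrightarrow> c)"
proof -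
  have "a \<Longrightarrow> b"
    by (simp add: a_def b_def)
  moreover have "b \<Longrightarrow> a"
    unfolding a_def b_def using hadamard_pow_extend[OF assms(2)] by simp
  moreover have "a \<Longrightarrow> c"
    unfolding a_def c_def using idempotent_decomposition_exists[OF assms(2,3)] by blast
  moreover have a if c: c
  proof -
    obtain k :: nat and l :: "nat \<Rightarrow> 'a" and E :: "nat \<Rightarrow> 'a mat" where
      "\<forall>i \<in> {1 .. k}. E i \<in> carrier_mat n n \<and> idempotent_mat (E i) \<and> zero_one_mat (E i)"
      "A = finsum_mat n (\<lambda>i. l i \<cdot>\<^sub>m E i) {1 .. k}"
      "\<forall>i \<in> {1 .. k}. \<forall>j \<in> {1 .. k}. i \<noteq> j \<longrightarrow> E i \<circ>\<^sub>m E j = 0\<^sub>m n n \<and> E i * E j = 0\<^sub>m n n"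
      using c unfolding c_def by (elim exE conjE)
    then show ?thesis
      unfolding a_def
      using idempotent_decomposition_hadamard_pow[of "{1..k}" E n A l] by blast
  qed
  ultimately show ?thesis by blast
qed

end
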